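(* There exists a constant $c>0$ such that for every binary string $x\in\{0,1\}^*$, $$\frac{1}{c}\, m^{\mathbf{0}'}(x)\;\le\;\liminf_{n\to\infty} m(x\mid n)\;\le\; c\, m^{\mathbf{0}'}(x).$$ That is, $\liminf_{n\to\infty} m(x\mid n)=m^{\mathbf{0}'}(x)$ up to a bounded multiplicative factor.
   Context: A function $a$ from binary strings (or natural numbers) to non-negative reals is a semimeasure if $\sum_x a(x)\le 1$. It is lower semicomputable if there is a computable total function $(x,s)\mapsto a(x,s)$ with rational values such that for each $x$ the sequence $a(x,0),a(x,1),\dots$ is nondecreasing with limit $a(x)$. The a priori probability $m$ is a maximal (up to a constant factor) lower semicomputable semimeasure. The conditional a priori probability $m(x\mid n)$ is a maximal (up to a constant factor) function $(x,n)\mapsto m(x\mid n)$ that is lower semicomputable (as a function of the pair $(x,n)$) and such that $x\mapsto m(x\mid n)$ is a semimeasure for every $n$. $\mathbf{0}'$ denotes the halting problem (the universal computably enumerable set), and $m^{\mathbf{0}'}$ is a maximal (up to a constant factor) semimeasure among those that are lower semicomputable relative to the oracle $\mathbf{0}'$. *)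

theory Defs
  imports "HOL-Analysis.Analysis" "HOL-Library.Nat_Bijection" "HOL-Library.Countable"
begin

text \<open>
  Partial recursive functions relative to an oracle \<open>A\<close>, presented as unary functions on the
  natural numbers; several arguments are packed with \<^const>\<open>prod_encode\<close>.  Primitive recursion
  maps \<open>(x, n)\<close> to \<open>h n\<close> where \<open>h 0 = f x\<close> and \<open>h (n + 1) = g (x, (n, h n))\<close>; minimisation maps
  \<open>x\<close> to the least \<open>n\<close> with \<open>f (x, n) = 0\<close>, provided \<open>f (x, i)\<close> is defined for all \<open>i < n\<close>.
\<close>

datatype prog =
    Zero
  | Succ
  | Fst
  | Snd
  | Oracle
  | Tuple prog prog
  | Comp prog prog
  | PrimRec prog prog
  | Mu prog

primrec eval :: "nat set \<Rightarrow> prog \<Rightarrow> nat \<Rightarrow> nat option" where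
  "eval A Zero x = Some 0"
| "eval A Succ x = Some (Suc x)"
| "eval A Fst x = Some (fst (prod_decode x))"
| "eval A Snd x = Some (snd (prod_decode x))"
| "eval A Oracle x = Some (if x \<in> A then 1 else 0)"
| "eval A (Tuple f g) x =
     Option.bind (eval A f x) (\<lambda>y. Option.bind (eval A g x) (\<lambda>z. Some (prod_encode (y, z))))"
| "eval A (Comp f g) x = Option.bind (eval A g x) (eval A f)"
| "eval A (PrimRec f g) x =
     (case prod_decode x of (a, n) \<Rightarrow>
        rec_nat (eval A f a)
          (\<lambda>k r. Option.bind r (\<lambda>y. eval A g (prod_encode (a, prod_encode (k, y))))) n)"
| "eval A (Mu f) x =
     (let P = (\<lambda>n. eval A f (prod_encode (x, n)) = Some 0 \<and>
                   (\<forall>i<n. \<exists>y. eval A f (prod_encode (x, i)) = Some (Suc y)))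
      in if \<exists>n. P n then Some (LEAST n. P n) else None)"

definition computable_in :: "nat set \<Rightarrow> (nat \<Rightarrow> nat) \<Rightarrow> bool" where
  "computable_in A f \<longleftrightarrow> (\<exists>p. \<forall>x. eval A p x = Some (f x))"

primrec prog_code :: "prog \<Rightarrow> nat" where
  "prog_code Zero = prod_encode (0, 0)"
| "prog_code Succ = prod_encode (1, 0)"
| "prog_code Fst = prod_encode (2, 0)"
| "prog_code Snd = prod_encode (3, 0)"
| "prog_code Oracle = prod_encode (4, 0)"
| "prog_code (Tuple f g) = prod_encode (5, prod_encode (prog_code f, prog_code g))"
| "prog_code (Comp f g) = prod_encode (6, prod_encode (prog_code f, prog_code g))"
| "prog_code (PrimRec f g) = prod_encode (7, prod_encode (prog_code f, prog_code g))"
| "prog_code (Mu f) = prod_encode (8, prog_code f)"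

lemma inj_prog_code: "inj prog_code"
proof (rule injI)
  show "p = q" if "prog_code p = prog_code q" for p q
    using that
  proof (induction p arbitrary: q)
    case (Tuple f g) then show ?case by (cases q) auto
  next
    case (Comp f g) then show ?case by (cases q) auto
  next
    case (PrimRec f g) then show ?case by (cases q) auto
  next
    case (Mu f) then show ?case by (cases q) auto
  qed (case_tac [!] q, auto)
qed

text \<open>Computability without an oracle is computability relative to the empty set.\<close>

definition halting_problem :: "nat set" where
  "halting_problem = {prod_encode (prog_code p, x) | p x. eval {} p x \<noteq> None}"

text \<open>Binary strings are identified with natural numbers by bijective base-2 numeration.\<close>

primrec string_code :: "bool list \<Rightarrow> nat" where
  "string_code [] = 0"
| "string_code (b # x) = 2 * string_code x + (if b then 2 else 1)"

lemma bij_string_code: "bij string_code"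
proof (rule bijI)
  show "inj string_code"
  proof (rule injI)
    show "x = y" if "string_code x = string_code y" for x y
      using that
    proof (induction x arbitrary: y)
      case Nil then show ?case by (cases y) (auto split: if_splits)
    next
      case (Cons b x)
      then show ?case
        by (cases y) (auto split: if_splits, (presburger | fastforce)+)
    qed
  qed
  have "\<exists>x. string_code x = n" for n
  proof (induction n rule: less_induct)
    case (less n)
    show ?case
    proof (cases "n = 0")
      case True
      then show ?thesis by (metis string_code.simps(1))
    next
      case False
      then have "(n - 1) div 2 < n" by presburger
      then obtain x where "string_code x = (n - 1) div 2"
        using less by blast
      with False have "string_code (even n # x) = n"
        by (simp, presburger)
      then show ?thesis by blast
    qed
  qed
  then show "surj string_code" by (metis surjI)
qed

definition pair_code :: "bool list \<times> nat \<Rightarrow> nat" where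
  "pair_code = (\<lambda>(x, n). prod_encode (string_code x, n))"

text \<open>
  The argument \<open>code\<close> is the numbering of the domain \<open>'a\<close>; rational values are numbered by
  \<^const>\<open>nat_to_rat_surj\<close>.
\<close>

definition computable_rat_in ::
  "nat set \<Rightarrow> ('a \<Rightarrow> nat) \<Rightarrow> ('a \<Rightarrow> nat \<Rightarrow> rat) \<Rightarrow> bool" where
  "computable_rat_in A code q \<longleftrightarrow>
     (\<exists>g. computable_in A g \<and> (\<forall>z s. q z s = nat_to_rat_surj (g (prod_encode (code z, s)))))"

definition lower_semicomputable_in ::
  "nat set \<Rightarrow> ('a \<Rightarrow> nat) \<Rightarrow> ('a \<Rightarrow> real) \<Rightarrow> bool" where
  "lower_semicomputable_in A code a \<longleftrightarrow>
     (\<exists>q. computable_rat_in A code q \<and>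
          (\<forall>z. incseq (q z) \<and> (\<lambda>s. real_of_rat (q z s)) \<longlonglongrightarrow> a z))"

definition semimeasure :: "('a \<Rightarrow> real) \<Rightarrow> bool" where
  "semimeasure a \<longleftrightarrow> (\<forall>x. 0 \<le> a x) \<and> a summable_on UNIV \<and> (\<Sum>\<^sub>\<infinity>x. a x) \<le> 1"

definition lsc_semimeasure_in :: "nat set \<Rightarrow> (bool list \<Rightarrow> real) \<Rightarrow> bool" where
  "lsc_semimeasure_in A a \<longleftrightarrow> lower_semicomputable_in A string_code a \<and> semimeasure a"

definition a_priori_probability_in :: "nat set \<Rightarrow> (bool list \<Rightarrow> real) \<Rightarrow> bool" where
  "a_priori_probability_in A m \<longleftrightarrow>
     lsc_semimeasure_in A m \<and>
     (\<forall>a. lsc_semimeasure_in A a \<longrightarrow> (\<exists>c>0. \<forall>x. a x \<le> c * m x))"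

definition lsc_conditional_semimeasure :: "(bool list \<Rightarrow> nat \<Rightarrow> real) \<Rightarrow> bool" where
  "lsc_conditional_semimeasure a \<longleftrightarrow>
     lower_semicomputable_in {} pair_code (\<lambda>(x, n). a x n) \<and>
     (\<forall>n. semimeasure (\<lambda>x. a x n))"

definition conditional_a_priori_probability :: "(bool list \<Rightarrow> nat \<Rightarrow> real) \<Rightarrow> bool" where
  "conditional_a_priori_probability m \<longleftrightarrow>
     lsc_conditional_semimeasure m \<and>
     (\<forall>a. lsc_conditional_semimeasure a \<longrightarrow> (\<exists>c>0. \<forall>x n. a x n \<le> c * m x n))"

end

theory Submission
  imports Defs
begin

text \<open>
  Upper bound: \<open>liminf m(x|n)\<close> itself need not be lower semicomputable in the halting problem, but
  it has a majorant that is.  Go through all requests ``raise \<open>m(x|n)\<close> to at least \<open>r\<close> for all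
  \<open>n \<ge> N\<close>'' and accept one whenever, together with the requests accepted before, it keeps every
  \<open>m(\<cdot>|n)\<close> a semimeasure.  Failure of this condition is an enumerable event, so the halting problem
  decides it.  The supremum of the accepted values is a semimeasure, and every request with
  \<open>r < liminf m(x|n)\<close> and \<open>N\<close> large is accepted, since it changes nothing.

  Lower bound: by the limit lemma, a function computable in the halting problem is the pointwise
  limit of a computable sequence.  Truncating the \<open>n\<close>-th guess at the lower approximation of
  \<open>m_halt\<close> where its total mass would exceed \<open>1\<close> gives a computable conditional semimeasure whose
  \<open>liminf\<close> is at least \<open>m_halt\<close>.
\<close>

subsection \<open>Closure properties of computable functions\<close>

abbreviation pfst :: "nat \<Rightarrow> nat" where "pfst z \<equiv> fst (prod_decode z)"
abbreviation psnd :: "nat \<Rightarrow> nat" where "psnd z \<equiv> snd (prod_decode z)"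

definition decidable_in :: "nat set \<Rightarrow> (nat \<Rightarrow> bool) \<Rightarrow> bool" where
  "decidable_in A P \<longleftrightarrow> computable_in A (\<lambda>x. of_bool (P x))"

named_theorems computable

text \<open>Not collected under \<open>computable\<close>: with an unknown outer function the rule
  would match every goal, so it is always instantiated by hand.\<close>

lemma computable_in_comp:
  assumes "computable_in A g" "computable_in A f"
  shows "computable_in A (\<lambda>x. g (f x))"
proof -
  obtain p q where "\<forall>x. eval A p x = Some (g x)" "\<forall>x. eval A q x = Some (f x)"
    using assms unfolding computable_in_def by blast
  then have "\<forall>x. eval A (Comp p q) x = Some (g (f x))" by simp
  then show ?thesis unfolding computable_in_def by blast
qed

lemma computable_in_pair [computable]:
  assumes "computable_in A f" "computable_in A g"
  shows "computable_in A (\<lambda>x. prod_encode (f x, g x))"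
proof -
  obtain p q where "\<forall>x. eval A p x = Some (f x)" "\<forall>x. eval A q x = Some (g x)"
    using assms unfolding computable_in_def by blast
  then have "\<forall>x. eval A (Tuple p q) x = Some (prod_encode (f x, g x))" by simp
  then show ?thesis unfolding computable_in_def by blast
qed

lemma computable_in_comp2:
  assumes "computable_in A (\<lambda>z. f (pfst z) (psnd z))" "computable_in A u" "computable_in A v"
  shows "computable_in A (\<lambda>x. f (u x) (v x))"
  using computable_in_comp[OF assms(1) computable_in_pair[OF assms(2,3)]] by simp

lemma computable_in_Suc [computable]:
  "computable_in A f \<Longrightarrow> computable_in A (\<lambda>x. Suc (f x))"
  using computable_in_comp[of A Suc f] unfolding computable_in_def by (metis eval.simps(2))

lemma computable_in_pfst [computable]:
  "computable_in A f \<Longrightarrow> computable_in A (\<lambda>x. pfst (f x))"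
  using computable_in_comp[of A pfst f] unfolding computable_in_def by (metis eval.simps(3))

lemma computable_in_psnd [computable]:
  "computable_in A f \<Longrightarrow> computable_in A (\<lambda>x. psnd (f x))"
  using computable_in_comp[of A psnd f] unfolding computable_in_def by (metis eval.simps(4))

lemma computable_in_id [computable]: "computable_in A (\<lambda>x. x)"
proof -
  have "\<forall>x. eval A (Tuple Fst Snd) x = Some x" by simp
  then show ?thesis unfolding computable_in_def by blast
qed

lemma computable_in_const [computable]: "computable_in A (\<lambda>x. c)"
proof (induction c)
  case 0
  then show ?case unfolding computable_in_def by (metis eval.simps(1))
next
  case (Suc c)
  then show ?case by (rule computable_in_Suc)
qed

lemma decidable_in_oracle: "decidable_in A (\<lambda>x. x \<in> A)"
proof -
  have "\<forall>x. eval A Oracle x = Some (of_bool (x \<in> A))" by simp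
  then show ?thesis unfolding decidable_in_def computable_in_def by blast
qed

text \<open>The recursion program is run on the pair of \<open>x\<close> and \<open>n x\<close>, so
  that base and step both see the whole input as a parameter.\<close>

lemma computable_in_rec_nat [computable]:
  assumes f: "computable_in A f"
    and g: "computable_in A (\<lambda>z. g (pfst z) (pfst (psnd z)) (psnd (psnd z)))"
    and n: "computable_in A n"
  shows "computable_in A (\<lambda>x. rec_nat (f x) (g x) (n x))"
proof -
  obtain p q where p: "\<And>x. eval A p x = Some (f x)"
    and q: "\<And>z. eval A q z = Some (g (pfst z) (pfst (psnd z)) (psnd (psnd z)))"
    using f g unfolding computable_in_def by blast
  have "eval A (PrimRec p q) (prod_encode (x, k)) = Some (rec_nat (f x) (g x) k)" for x k
    by (induction k) (simp_all add: p q)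
  then have "eval A (PrimRec p q) z = Some (rec_nat (f (pfst z)) (g (pfst z)) (psnd z))" for z
    by (metis prod.collapse prod_decode_inverse)
  then have "computable_in A (\<lambda>z. rec_nat (f (pfst z)) (g (pfst z)) (psnd z))"
    unfolding computable_in_def by blast
  from computable_in_comp[OF this computable_in_pair[OF computable_in_id n]]
  show ?thesis by simp
qed

lemma computable_in_add [computable]:
  assumes "computable_in A f" "computable_in A g"
  shows "computable_in A (\<lambda>x. f x + g x)"
proof -
  have "computable_in A (\<lambda>x. rec_nat (f x) (\<lambda>k r. Suc r) (g x))"
    by (intro computable assms)
  moreover have "rec_nat a (\<lambda>k r. Suc r) b = a + b" for a b :: nat by (induction b) auto
  ultimately show ?thesis by simp
qed

lemma computable_in_mult [computable]:
  assumes "computable_in A f" "computable_in A g"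
  shows "computable_in A (\<lambda>x. f x * g x)"
proof -
  have "computable_in A (\<lambda>x. rec_nat 0 (\<lambda>k r. r + f x) (g x))"
    by (intro computable computable_in_comp[OF assms(1)] assms)
  moreover have "rec_nat 0 (\<lambda>k r. r + a) b = a * b" for a b :: nat by (induction b) auto
  ultimately show ?thesis by simp
qed

lemma computable_in_diff [computable]:
  assumes "computable_in A f" "computable_in A g"
  shows "computable_in A (\<lambda>x. f x - g x)"
proof -
  \<comment> \<open>The predecessor is a recursion that forgets the previous value and returns the
    index; truncated subtraction iterates it.\<close>
  have "computable_in A (\<lambda>x. rec_nat 0 (\<lambda>k r. k) x)"
    by (intro computable)
  moreover have "rec_nat 0 (\<lambda>k r. k) b = b - 1" for b :: nat by (cases b) auto
  ultimately have pred: "computable_in A (\<lambda>x. x - 1)" by simp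
  have "computable_in A (\<lambda>x. rec_nat (f x) (\<lambda>k r. r - 1) (g x))"
    by (intro computable computable_in_comp[OF pred] assms)
  moreover have "rec_nat a (\<lambda>k r. r - 1) b = a - b" for a b :: nat by (induction b) auto
  ultimately show ?thesis by simp
qed

lemma computable_in_power [computable]:
  assumes "computable_in A f" "computable_in A g"
  shows "computable_in A (\<lambda>x. f x ^ g x)"
proof -
  have "computable_in A (\<lambda>x. rec_nat 1 (\<lambda>k r. f x * r) (g x))"
    by (intro computable computable_in_comp[OF assms(1)] assms)
  moreover have "rec_nat 1 (\<lambda>k r. a * r) b = a ^ b" for a b :: nat by (induction b) auto
  ultimately show ?thesis by simp
qed

lemma decidable_in_comp:
  "decidable_in A P \<Longrightarrow> computable_in A f \<Longrightarrow> decidable_in A (\<lambda>x. P (f x))"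
  unfolding decidable_in_def by (rule computable_in_comp)

lemma computable_in_of_bool [computable]:
  "decidable_in A P \<Longrightarrow> computable_in A (\<lambda>x. of_bool (P x))"
  unfolding decidable_in_def .

lemma decidable_in_le [computable]:
  assumes "computable_in A f" "computable_in A g"
  shows "decidable_in A (\<lambda>x. f x \<le> g x)"
proof -
  have "computable_in A (\<lambda>x. 1 - (f x - g x))" by (intro computable assms)
  moreover have "1 - (a - b) = of_bool (a \<le> b)" for a b :: nat by auto
  ultimately show ?thesis unfolding decidable_in_def by simp
qed

lemma decidable_in_not [computable]:
  assumes "decidable_in A P"
  shows "decidable_in A (\<lambda>x. \<not> P x)"
proof -
  have "computable_in A (\<lambda>x. 1 - of_bool (P x))" by (intro computable assms)
  moreover have "1 - of_bool b = (of_bool (\<not> b) :: nat)" for b by auto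
  ultimately show ?thesis unfolding decidable_in_def by simp
qed

lemma decidable_in_conj [computable]:
  assumes "decidable_in A P" "decidable_in A Q"
  shows "decidable_in A (\<lambda>x. P x \<and> Q x)"
  unfolding decidable_in_def of_bool_conj by (intro computable assms)

lemma decidable_in_disj [computable]:
  assumes "decidable_in A P" "decidable_in A Q"
  shows "decidable_in A (\<lambda>x. P x \<or> Q x)"
proof -
  have "decidable_in A (\<lambda>x. \<not> (\<not> P x \<and> \<not> Q x))" by (intro computable assms)
  then show ?thesis by simp
qed

lemma decidable_in_eq [computable]:
  assumes "computable_in A f" "computable_in A g"
  shows "decidable_in A (\<lambda>x. f x = g x)"
  unfolding eq_iff by (intro computable assms)

lemma decidable_in_less [computable]:
  assumes "computable_in A f" "computable_in A g"
  shows "decidable_in A (\<lambda>x. f x < g x)"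
  unfolding not_le[symmetric] by (intro computable assms)

lemma computable_in_if [computable]:
  assumes "decidable_in A P" "computable_in A f" "computable_in A g"
  shows "computable_in A (\<lambda>x. if P x then f x else g x)"
proof -
  have "computable_in A (\<lambda>x. of_bool (P x) * f x + of_bool (\<not> P x) * g x)"
    by (intro computable assms)
  moreover have "of_bool b * u + of_bool (\<not> b) * v = (if b then u else v)" for b and u v :: nat
    by auto
  ultimately show ?thesis by simp
qed

lemma computable_in_sum [computable]:
  assumes "computable_in A (\<lambda>z. f (pfst z) (psnd z))" "computable_in A b"
  shows "computable_in A (\<lambda>x. \<Sum>i<b x. f x i)"
proof -
  have "computable_in A (\<lambda>x. rec_nat 0 (\<lambda>k r. r + f x k) (b x))"
    by (intro computable computable_in_comp2[OF assms(1)] assms)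
  moreover have "rec_nat 0 (\<lambda>k r. r + h k) n = (\<Sum>i<n. h i)" for h :: "nat \<Rightarrow> nat" and n
    by (induction n) auto
  ultimately show ?thesis by simp
qed

lemma computable_in_Max [computable]:
  assumes "computable_in A (\<lambda>z. f (pfst z) (psnd z))" "computable_in A b"
  shows "computable_in A (\<lambda>x. Max (f x ` {..b x}))"
proof -
  have "computable_in A (\<lambda>x. rec_nat (f x 0) (\<lambda>k r. if f x (Suc k) \<le> r then r else f x (Suc k)) (b x))"
    by (intro computable computable_in_comp2[OF assms(1)] assms)
  moreover have "rec_nat (h 0) (\<lambda>k r. if h (Suc k) \<le> r then r else h (Suc k)) n = Max (h ` {..n})"
    for h :: "nat \<Rightarrow> nat" and n
    by (induction n) (simp_all add: atMost_Suc max_def)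
  ultimately show ?thesis by simp
qed

lemma decidable_in_bex [computable]:
  assumes "decidable_in A (\<lambda>z. P (pfst z) (psnd z))" "computable_in A b"
  shows "decidable_in A (\<lambda>x. \<exists>i<b x. P x i)"
proof -
  have "decidable_in A (\<lambda>x. 0 < (\<Sum>i<b x. of_bool (P x i)::nat))"
    by (intro computable assms)
  moreover have "0 < (\<Sum>i<b x. of_bool (P x i)::nat) \<longleftrightarrow> (\<exists>i<b x. P x i)" for x
    by (auto simp: zero_less_iff_neq_zero simp del: sum_of_bool_eq)
  ultimately show ?thesis by simp
qed

lemma decidable_in_ball [computable]:
  assumes "decidable_in A (\<lambda>z. P (pfst z) (psnd z))" "computable_in A b"
  shows "decidable_in A (\<lambda>x. \<forall>i<b x. P x i)"
proof -
  have "decidable_in A (\<lambda>x. \<not> (\<exists>i<b x. \<not> P x i))" by (intro computable assms)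
  then show ?thesis by simp
qed

lemma computable_in_div [computable]:
  assumes "computable_in A f" "computable_in A g"
  shows "computable_in A (\<lambda>x. f x div g x)"
proof -
  \<comment> \<open>The quotient counts the positive multiples of the divisor up to the dividend;
    the guard \<open>0 < g x\<close> reproduces the value 0 of division by zero.\<close>
  have "computable_in A (\<lambda>x. \<Sum>i<f x. of_bool (0 < g x \<and> Suc i * g x \<le> f x))"
    by (intro computable computable_in_comp[OF assms(1)] computable_in_comp[OF assms(2)] assms)
  moreover have "(\<Sum>i<a. of_bool (0 < b \<and> Suc i * b \<le> a)) = a div b" for a b :: nat
  proof (cases "b = 0")
    case False
    have "i < a \<and> 0 < b \<and> Suc i * b \<le> a \<longleftrightarrow> i < a div b" for i
      using False less_eq_div_iff_mult_less_eq[of b "Suc i" a] div_le_dividend[of a b] by linarith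
    then have "{i. i < a \<and> 0 < b \<and> Suc i * b \<le> a} = {..<a div b}" by blast
    moreover have "(\<Sum>i<a. of_bool (0 < b \<and> Suc i * b \<le> a)) =
        card {i. i < a \<and> 0 < b \<and> Suc i * b \<le> a}"
      by (simp add: Int_def del: mult_Suc)
    ultimately show ?thesis by simp
  qed simp
  ultimately show ?thesis by simp
qed

lemma decidable_in_even [computable]:
  assumes "computable_in A f"
  shows "decidable_in A (\<lambda>x. even (f x))"
proof -
  have "decidable_in A (\<lambda>x. f x div 2 * 2 = f x)" by (intro computable assms)
  moreover have "a div 2 * 2 = a \<longleftrightarrow> even a" for a :: nat by presburger
  ultimately show ?thesis by simp
qed

lemma decidable_in_set_decode [computable]:
  assumes "computable_in A f" "computable_in A S"
  shows "decidable_in A (\<lambda>x. f x \<in> set_decode (S x))"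
  unfolding set_decode_def mem_Collect_eq by (intro computable assms)

section \<open>Unbounded search and the halting problem\<close>

lemma eval_Mu_eq_Some_iff:
  "eval A (Mu f) x = Some n \<longleftrightarrow>
     eval A f (prod_encode (x, n)) = Some 0 \<and>
     (\<forall>i<n. \<exists>y. eval A f (prod_encode (x, i)) = Some (Suc y))" (is "_ \<longleftrightarrow> ?P n")
proof -
  have uniq: "k = n" if "?P k" "?P n" for k n
  proof (rule ccontr)
    assume "k \<noteq> n"
    then consider "k < n" | "n < k" by linarith
    then show False using that by cases fastforce+
  qed
  show ?thesis
  proof
    assume "eval A (Mu f) x = Some n"
    then have ex: "\<exists>k. ?P k" and n: "n = (LEAST k. ?P k)"
      by (auto simp: Let_def split: if_splits)
    show "?P n" unfolding n by (rule LeastI_ex[OF ex])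
  next
    assume n: "?P n"
    then have "(LEAST k. ?P k) = n" by (rule Least_equality) (drule uniq[OF _ n], simp)
    then show "eval A (Mu f) x = Some n" using n by (auto simp: Let_def)
  qed
qed

text \<open>A search for a witness halts exactly when there is one, so a single query about the
  fixed program \<open>Mu p\<close> and the input \<open>x\<close> decides existence. Injectivity of
  \<open>prog_code\<close> ensures that the query concerns this program only.\<close>

lemma decidable_in_halting_problem_ex:
  assumes "decidable_in {} (\<lambda>z. P (pfst z) (psnd z))"
  shows "decidable_in halting_problem (\<lambda>x. \<exists>n. P x n)"
proof -
  \<comment> \<open>Negated because \<open>Mu\<close> searches for the value 0.\<close>
  have "computable_in {} (\<lambda>z. of_bool (\<not> P (pfst z) (psnd z)))" by (intro computable assms)
  then obtain p where p: "eval {} p z = Some (of_bool (\<not> P (pfst z) (psnd z)))" for z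
    unfolding computable_in_def by blast
  have "(\<exists>n. eval {} (Mu p) x = Some n) \<longleftrightarrow> (\<exists>n. P x n)" for x
  proof
    assume "\<exists>n. P x n"
    then obtain n where n: "P x n" "\<And>i. i < n \<Longrightarrow> \<not> P x i" using exists_least_iff[of "P x"] by blast
    then show "\<exists>n. eval {} (Mu p) x = Some n"
      unfolding eval_Mu_eq_Some_iff by (intro exI[of _ n]) (auto simp: p)
  qed (unfold eval_Mu_eq_Some_iff, auto simp: p)
  then have "prod_encode (prog_code (Mu p), x) \<in> halting_problem \<longleftrightarrow> (\<exists>n. P x n)" for x
    unfolding halting_problem_def
    by (simp only: mem_Collect_eq prod_encode_eq prod.inject inj_eq[OF inj_prog_code]) auto
  moreover have "decidable_in halting_problem
      (\<lambda>x. prod_encode (prog_code (Mu p), x) \<in> halting_problem)"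
    by (rule decidable_in_comp[OF decidable_in_oracle]) (intro computable)
  ultimately show ?thesis by simp
qed

subsection \<open>The limit lemma\<close>

text \<open>
  Finite stages, coded as bit sets, of the set inductively generated by the step predicate \<open>J\<close>.
\<close>

definition stages :: "(nat \<Rightarrow> nat \<Rightarrow> nat \<Rightarrow> bool) \<Rightarrow> nat \<Rightarrow> nat" where
  "stages J n = rec_nat 0 (\<lambda>n S. \<Sum>t<n. of_bool (J n S t) * 2 ^ t) n"

lemma set_decode_sum:
  fixes n :: nat
  shows "set_decode (\<Sum>t<n. of_bool (P t) * 2 ^ t) = {t. t < n \<and> P t}"
proof -
  have "(\<Sum>t<n. of_bool (P t) * 2 ^ t) = set_encode {t \<in> {..<n}. P t}"
    by (simp add: set_encode_def Int_def)
  then show ?thesis by simp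
qed

lemma not_in_stages_0 [simp]: "t \<notin> set_decode (stages J 0)"
  by (simp add: stages_def)

lemma in_stages_Suc_iff:
  "t \<in> set_decode (stages J (Suc n)) \<longleftrightarrow> t < n \<and> J n (stages J n) t"
  by (simp only: stages_def old.nat.rec(2) set_decode_sum mem_Collect_eq)

text \<open>Stage \<open>n + 1\<close> is recomputed from stage \<open>n\<close>, not added to it,
  so membership at one stage need not persist. The working notion is therefore membership at all
  large stages.\<close>

lemma eventually_in_stages:
  assumes "\<forall>\<^sub>F n in sequentially. J n (stages J n) t"
  shows "\<forall>\<^sub>F n in sequentially. t \<in> set_decode (stages J n)"
proof -
  have "\<forall>\<^sub>F n in sequentially. t \<in> set_decode (stages J (Suc n))"
    using assms eventually_gt_at_top[of t]
    by eventually_elim (simp add: in_stages_Suc_iff)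
  then show ?thesis by (subst (asm) eventually_sequentially_Suc)
qed

lemma computable_in_stages:
  assumes "decidable_in A (\<lambda>z. J (pfst z) (pfst (psnd z)) (psnd (psnd z)))"
    and "computable_in A n"
  shows "computable_in A (\<lambda>x. stages J (n x))"
proof -
  have J: "decidable_in A (\<lambda>x. J (a x) (b x) (c x))"
    if "computable_in A a" "computable_in A b" "computable_in A c" for a b c
    using decidable_in_comp[OF assms(1), of "\<lambda>x. prod_encode (a x, prod_encode (b x, c x))"] that
    by (simp add: computable)
  show ?thesis
    unfolding stages_def by (intro computable J assms)
qed

section \<open>Enumeration of the program codes\<close>

definition code_step :: "nat \<Rightarrow> nat \<Rightarrow> nat \<Rightarrow> bool" where
  "code_step n S c \<longleftrightarrow>
     (pfst c < 5 \<and> psnd c = 0) \<or>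
     (5 \<le> pfst c \<and> pfst c \<le> 7 \<and> pfst (psnd c) \<in> set_decode S \<and> psnd (psnd c) \<in> set_decode S) \<or>
     (pfst c = 8 \<and> psnd c \<in> set_decode S)"

definition code_stages :: "nat \<Rightarrow> nat" where
  "code_stages = stages code_step"

lemma in_code_stages_Suc_iff:
  "c \<in> set_decode (code_stages (Suc n)) \<longleftrightarrow> c < n \<and> code_step n (code_stages n) c"
  by (simp add: code_stages_def in_stages_Suc_iff)

lemma eventually_in_code_stages:
  "\<forall>\<^sub>F n in sequentially. prog_code p \<in> set_decode (code_stages n)"
proof -
  have step: "\<forall>\<^sub>F n in sequentially. c \<in> set_decode (code_stages n)"
    if "\<forall>\<^sub>F n in sequentially. code_step n (code_stages n) c" for c
    using eventually_in_stages[of code_step c] that by (simp add: code_stages_def)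
  show ?thesis
    by (induction p; rule step)
      (auto simp: code_step_def elim: eventually_elim2 eventually_mono)
qed

lemma in_code_stages_imp:
  "c \<in> set_decode (code_stages n) \<Longrightarrow> c \<in> range prog_code"
proof (induction n arbitrary: c)
  case (Suc n)
  obtain k d where c: "c = prod_encode (k, d)" by (metis prod.collapse prod_decode_inverse)
  obtain f g where d: "d = prod_encode (f, g)" by (metis prod.collapse prod_decode_inverse)
  from Suc.prems consider "k < 5" "d = 0"
    | "5 \<le> k" "k \<le> 7" "f \<in> set_decode (code_stages n)" "g \<in> set_decode (code_stages n)"
    | "k = 8" "d \<in> set_decode (code_stages n)"
    by (auto simp: in_code_stages_Suc_iff code_step_def c d)
  then show ?case
  proof cases
    case 1
    then have "k = 0 \<or> k = 1 \<or> k = 2 \<or> k = 3 \<or> k = 4" by linarith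
    then show ?thesis
      unfolding c \<open>d = 0\<close>
      by (metis prog_code.simps(1-5) rangeI)
  next
    case 2
    then obtain p q where "f = prog_code p" "g = prog_code q" using Suc.IH by blast
    moreover have "k = 5 \<or> k = 6 \<or> k = 7" using 2 by linarith
    ultimately show ?thesis
      unfolding c d by (metis prog_code.simps(6-8) rangeI)
  next
    case 3
    then obtain p where "d = prog_code p" using Suc.IH by blast
    then show ?thesis unfolding c \<open>k = 8\<close> by (metis prog_code.simps(9) rangeI)
  qed
qed (simp add: code_stages_def)

text \<open>
  The staged graph of the universal function \<open>(c, x) \<mapsto> y\<close>.  It may contain junk for numbers \<open>c\<close>
  that are not program codes, so \<open>code_stages\<close> is needed separately.
\<close>

abbreviation in_graph :: "nat \<Rightarrow> nat \<Rightarrow> nat \<Rightarrow> nat \<Rightarrow> bool" where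
  "in_graph S c x y \<equiv> prod_encode (c, prod_encode (x, y)) \<in> set_decode S"

text \<open>The disjuncts are the evaluation rules, sorted by the constructor tags of
  \<open>prog_code\<close>; tag 4 answers 0 because the oracle is empty. Intermediate values are
  bounded by the stage \<open>n\<close> to keep the step decidable, which excludes nothing in the
  limit.\<close>

definition graph_step :: "nat \<Rightarrow> nat \<Rightarrow> nat \<Rightarrow> nat \<Rightarrow> nat \<Rightarrow> bool" where
  "graph_step n S c x y \<longleftrightarrow>
     (pfst c = 0 \<and> y = 0) \<or> (pfst c = 1 \<and> y = Suc x) \<or> (pfst c = 2 \<and> y = pfst x) \<or>
     (pfst c = 3 \<and> y = psnd x) \<or> (pfst c = 4 \<and> y = 0) \<or>
     (pfst c = 5 \<and> in_graph S (pfst (psnd c)) x (pfst y) \<and> in_graph S (psnd (psnd c)) x (psnd y)) \<or>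
     (pfst c = 6 \<and> (\<exists>u<n. in_graph S (psnd (psnd c)) x u \<and> in_graph S (pfst (psnd c)) u y)) \<or>
     (pfst c = 7 \<and> psnd x = 0 \<and> in_graph S (pfst (psnd c)) (pfst x) y) \<or>
     (pfst c = 7 \<and> 0 < psnd x \<and>
       (\<exists>r<n. in_graph S c (prod_encode (pfst x, psnd x - 1)) r \<and>
         in_graph S (psnd (psnd c)) (prod_encode (pfst x, prod_encode (psnd x - 1, r))) y)) \<or>
     (pfst c = 8 \<and> in_graph S (psnd c) (prod_encode (x, y)) 0 \<and>
       (\<forall>i<y. \<exists>v<n. in_graph S (psnd c) (prod_encode (x, i)) (Suc v)))"

definition graph_stages :: "nat \<Rightarrow> nat" where
  "graph_stages = stages (\<lambda>n S t. graph_step n S (pfst t) (pfst (psnd t)) (psnd (psnd t)))"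

lemma in_graph_stages_Suc_iff:
  "in_graph (graph_stages (Suc n)) c x y \<longleftrightarrow>
     prod_encode (c, prod_encode (x, y)) < n \<and> graph_step n (graph_stages n) c x y"
  by (simp add: graph_stages_def in_stages_Suc_iff)

lemma eventually_in_graph_stages:
  assumes "\<forall>\<^sub>F n in sequentially. graph_step n (graph_stages n) c x y"
  shows "\<forall>\<^sub>F n in sequentially. in_graph (graph_stages n) c x y"
  unfolding graph_stages_def
  by (rule eventually_in_stages) (use assms in \<open>simp add: graph_stages_def\<close>)

text \<open>The induction is on the stage, not on the program: the clause for primitive recursion
  refers back to the same program, while every clause looks only at the preceding stage.\<close>

lemma in_graph_stages_imp_eval:
  "in_graph (graph_stages n) (prog_code p) x y \<Longrightarrow> eval {} p x = Some y"
proof (induction n arbitrary: p x y)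
  case 0
  then show ?case by (simp add: graph_stages_def)
next
  case (Suc n)
  then have step: "graph_step n (graph_stages n) (prog_code p) x y"
    by (simp add: in_graph_stages_Suc_iff)
  show ?case
  proof (cases p)
    case (Tuple f g)
    then have "eval {} f x = Some (pfst y)" "eval {} g x = Some (psnd y)"
      using step by (auto simp: graph_step_def intro!: Suc.IH)
    then show ?thesis by (simp add: Tuple)
  next
    case (Comp f g)
    then obtain u where "eval {} g x = Some u" "eval {} f u = Some y"
      using step by (auto simp: graph_step_def intro!: Suc.IH)
    then show ?thesis by (simp add: Comp)
  next
    case (PrimRec f g)
    obtain a k where x: "x = prod_encode (a, k)" by (metis prod.collapse prod_decode_inverse)
    show ?thesis
    proof (cases k)
      case 0
      then have "eval {} f a = Some y"
        using step by (auto simp: graph_step_def PrimRec x intro!: Suc.IH)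
      then show ?thesis by (simp add: PrimRec x 0)
    next
      case (Suc j)
      then obtain r where "in_graph (graph_stages n) (prog_code p) (prod_encode (a, j)) r"
        "in_graph (graph_stages n) (prog_code g) (prod_encode (a, prod_encode (j, r))) y"
        using step by (auto simp: graph_step_def PrimRec x)
      then have "eval {} p (prod_encode (a, j)) = Some r"
        "eval {} g (prod_encode (a, prod_encode (j, r))) = Some y"
        by (blast intro: Suc.IH)+
      then show ?thesis by (simp add: PrimRec x Suc)
    qed
  next
    case (Mu f)
    then have "eval {} f (prod_encode (x, y)) = Some 0"
      "\<forall>i<y. \<exists>v. eval {} f (prod_encode (x, i)) = Some (Suc v)"
      using step by (auto simp: graph_step_def intro!: Suc.IH)
    then show ?thesis unfolding Mu eval_Mu_eq_Some_iff by blast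
  qed (use step in \<open>auto simp: graph_step_def\<close>)
qed

text \<open>Each value rests on finitely many smaller ones, which are eventually present together.
  The induction is on the program, with an inner one on the recursion argument.\<close>

lemma eval_imp_eventually_in_graph_stages:
  "eval {} p x = Some y \<Longrightarrow> \<forall>\<^sub>F n in sequentially. in_graph (graph_stages n) (prog_code p) x y"
proof (induction p arbitrary: x y)
  case (Tuple f g)
  then have "\<forall>\<^sub>F n in sequentially. in_graph (graph_stages n) (prog_code f) x (pfst y)"
    "\<forall>\<^sub>F n in sequentially. in_graph (graph_stages n) (prog_code g) x (psnd y)"
    by (auto simp: bind_eq_Some_conv)
  then have "\<forall>\<^sub>F n in sequentially. graph_step n (graph_stages n) (prog_code (Tuple f g)) x y"
    by eventually_elim (simp add: graph_step_def)
  then show ?case by (rule eventually_in_graph_stages)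
next
  case (Comp f g)
  then obtain u where u: "eval {} g x = Some u" "eval {} f u = Some y"
    by (auto simp: bind_eq_Some_conv)
  from Comp.IH(2)[OF u(1)] Comp.IH(1)[OF u(2)] eventually_gt_at_top[of u]
  have "\<forall>\<^sub>F n in sequentially. graph_step n (graph_stages n) (prog_code (Comp f g)) x y"
    by eventually_elim (auto simp add: graph_step_def)
  then show ?case by (rule eventually_in_graph_stages)
next
  case (PrimRec f g)
  obtain a k where x: "x = prod_encode (a, k)" by (metis prod.collapse prod_decode_inverse)
  have "\<forall>\<^sub>F n in sequentially. in_graph (graph_stages n) (prog_code (PrimRec f g)) (prod_encode (a, k)) y"
    using PrimRec.prems unfolding x
  proof (induction k arbitrary: y)
    case 0
    then have "\<forall>\<^sub>F n in sequentially. in_graph (graph_stages n) (prog_code f) a y"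
      by (intro PrimRec.IH) simp
    then have "\<forall>\<^sub>F n in sequentially.
        graph_step n (graph_stages n) (prog_code (PrimRec f g)) (prod_encode (a, 0)) y"
      by eventually_elim (simp add: graph_step_def)
    then show ?case by (rule eventually_in_graph_stages)
  next
    case (Suc k)
    then obtain r where r: "eval {} (PrimRec f g) (prod_encode (a, k)) = Some r"
      "eval {} g (prod_encode (a, prod_encode (k, r))) = Some y"
      by (auto simp: bind_eq_Some_conv)
    from Suc.IH[OF r(1)] PrimRec.IH(2)[OF r(2)] eventually_gt_at_top[of r]
    have "\<forall>\<^sub>F n in sequentially.
        graph_step n (graph_stages n) (prog_code (PrimRec f g)) (prod_encode (a, Suc k)) y"
      by eventually_elim (auto simp add: graph_step_def)
    then show ?case by (rule eventually_in_graph_stages)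
  qed
  then show ?case unfolding x .
next
  case (Mu f)
  then have f: "eval {} f (prod_encode (x, y)) = Some 0"
      "\<forall>i<y. \<exists>v. eval {} f (prod_encode (x, i)) = Some (Suc v)"
    unfolding eval_Mu_eq_Some_iff by blast+
  have "\<forall>\<^sub>F n in sequentially. \<exists>v<n. in_graph (graph_stages n) (prog_code f) (prod_encode (x, i)) (Suc v)"
    if i: "i < y" for i
  proof -
    obtain v where "eval {} f (prod_encode (x, i)) = Some (Suc v)" using f i by blast
    from Mu.IH[OF this] eventually_gt_at_top[of v] show ?thesis by eventually_elim blast
  qed
  then have "\<forall>\<^sub>F n in sequentially. \<forall>i\<in>{..<y}.
      \<exists>v<n. in_graph (graph_stages n) (prog_code f) (prod_encode (x, i)) (Suc v)"
    by (intro eventually_ball_finite) auto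
  with Mu.IH[OF f(1)]
  have "\<forall>\<^sub>F n in sequentially. graph_step n (graph_stages n) (prog_code (Mu f)) x y"
    by eventually_elim (simp add: graph_step_def)
  then show ?case by (rule eventually_in_graph_stages)
qed (rule eventually_in_graph_stages, simp add: graph_step_def)+

section \<open>Computable approximation of the halting problem\<close>

definition halting_approx :: "nat \<Rightarrow> nat \<Rightarrow> bool" where
  "halting_approx n z \<longleftrightarrow> pfst z \<in> set_decode (code_stages n) \<and>
     (\<exists>y<n. in_graph (graph_stages n) (pfst z) (psnd z) y)"

lemma decidable_in_halting_approx:
  "decidable_in A (\<lambda>z. halting_approx (pfst z) (psnd z))"
proof -
  have c: "computable_in A (\<lambda>x. code_stages (f x))" if "computable_in A f" for f
    unfolding code_stages_def
    by (rule computable_in_stages[OF _ that]) (unfold code_step_def, intro computable)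
  have g: "computable_in A (\<lambda>x. graph_stages (f x))" if "computable_in A f" for f
    unfolding graph_stages_def
    by (rule computable_in_stages[OF _ that]) (unfold graph_step_def, intro computable)
  show ?thesis
    unfolding halting_approx_def by (intro computable c g)
qed

text \<open>The error is one-sided: soundness of the stages rules out false positives at every
  \<open>n\<close>, and completeness brings in each true member from some stage on.\<close>

lemma eventually_halting_approx:
  "\<forall>\<^sub>F n in sequentially. halting_approx n z \<longleftrightarrow> z \<in> halting_problem"
proof (cases "z \<in> halting_problem")
  case True
  then obtain p x y where z: "z = prod_encode (prog_code p, x)" and "eval {} p x = Some y"
    unfolding halting_problem_def by blast
  from eval_imp_eventually_in_graph_stages[OF this(2)] eventually_in_code_stages[of p]
    eventually_gt_at_top[of y]
  show ?thesis
    by eventually_elim (use True in \<open>auto simp: halting_approx_def z\<close>)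
next
  case False
  have "\<not> halting_approx n z" for n
  proof
    assume h: "halting_approx n z"
    then obtain p where p: "pfst z = prog_code p"
      using in_code_stages_imp unfolding halting_approx_def by blast
    with h obtain y where "eval {} p (psnd z) = Some y"
      unfolding halting_approx_def using in_graph_stages_imp_eval by metis
    then have "prod_encode (prog_code p, psnd z) \<in> halting_problem"
      unfolding halting_problem_def by blast
    then show False using False by (simp flip: p)
  qed
  then show ?thesis using False by simp
qed

text \<open>By induction on the program, each constructor acts on total computable guesses. A
  halting computation uses finitely many intermediate values, so their guesses are eventually all
  correct at once; nothing is claimed where the program diverges.\<close>

lemma limit_lemma_prog:
  "\<exists>e. computable_in {} (\<lambda>z. e (pfst z) (psnd z)) \<and>
     (\<forall>x y. eval halting_problem p x = Some y \<longrightarrow> (\<forall>\<^sub>F n in sequentially. e n x = y))"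
proof (induction p)
  case Zero
  show ?case by (rule exI[of _ "\<lambda>n x. 0"]) (auto intro: computable)
next
  case Succ
  show ?case by (rule exI[of _ "\<lambda>n x. Suc x"]) (auto intro!: computable)
next
  case Fst
  show ?case by (rule exI[of _ "\<lambda>n x. pfst x"]) (auto intro!: computable)
next
  case Snd
  show ?case by (rule exI[of _ "\<lambda>n x. psnd x"]) (auto intro!: computable)
next
  case Oracle
  have "\<forall>\<^sub>F n in sequentially. of_bool (halting_approx n x) = y"
    if "eval halting_problem Oracle x = Some y" for x y
    using eventually_halting_approx[of x] by eventually_elim (use that in auto)
  then show ?case
    by (intro exI[of _ "\<lambda>n x. of_bool (halting_approx n x)"] conjI allI impI)
      (rule computable_in_of_bool decidable_in_halting_approx | blast)+
next
  case (Tuple f g)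
  then obtain d e where d: "computable_in {} (\<lambda>z. d (pfst z) (psnd z))"
      "\<And>x y. eval halting_problem f x = Some y \<Longrightarrow> \<forall>\<^sub>F n in sequentially. d n x = y"
    and e: "computable_in {} (\<lambda>z. e (pfst z) (psnd z))"
      "\<And>x y. eval halting_problem g x = Some y \<Longrightarrow> \<forall>\<^sub>F n in sequentially. e n x = y"
    by blast
  have "\<forall>\<^sub>F n in sequentially. prod_encode (d n x, e n x) = y"
    if xy: "eval halting_problem (Tuple f g) x = Some y" for x y
  proof -
    obtain u v where uv: "eval halting_problem f x = Some u" "eval halting_problem g x = Some v"
      "y = prod_encode (u, v)" using xy by (auto simp: bind_eq_Some_conv)
    from d(2)[OF uv(1)] e(2)[OF uv(2)] show ?thesis by eventually_elim (simp add: uv(3))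
  qed
  moreover have "computable_in {} (\<lambda>z. prod_encode (d (pfst z) (psnd z), e (pfst z) (psnd z)))"
    by (intro computable d e)
  ultimately show ?case
    by (intro exI[of _ "\<lambda>n x. prod_encode (d n x, e n x)"]) blast
next
  case (Comp f g)
  then obtain d e where d: "computable_in {} (\<lambda>z. d (pfst z) (psnd z))"
      "\<And>x y. eval halting_problem f x = Some y \<Longrightarrow> \<forall>\<^sub>F n in sequentially. d n x = y"
    and e: "computable_in {} (\<lambda>z. e (pfst z) (psnd z))"
      "\<And>x y. eval halting_problem g x = Some y \<Longrightarrow> \<forall>\<^sub>F n in sequentially. e n x = y"
    by blast
  have "\<forall>\<^sub>F n in sequentially. d n (e n x) = y"
    if xy: "eval halting_problem (Comp f g) x = Some y" for x y
  proof -
    obtain u where u: "eval halting_problem g x = Some u" "eval halting_problem f u = Some y"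
      using xy by (auto simp: bind_eq_Some_conv)
    \<comment> \<open>The inner guess becomes equal to \<open>u\<close>, so the outer guesses are
      eventually taken at one fixed argument.\<close>
    from e(2)[OF u(1)] d(2)[OF u(2)] show ?thesis by eventually_elim simp
  qed
  moreover have "computable_in {} (\<lambda>z. d (pfst z) (e (pfst z) (psnd z)))"
    by (intro computable computable_in_comp2[OF d(1)] e)
  ultimately show ?case by (intro exI[of _ "\<lambda>n x. d n (e n x)"]) blast
next
  case (PrimRec f g)
  then obtain d e where d: "computable_in {} (\<lambda>z. d (pfst z) (psnd z))"
      "\<And>x y. eval halting_problem f x = Some y \<Longrightarrow> \<forall>\<^sub>F n in sequentially. d n x = y"
    and e: "computable_in {} (\<lambda>z. e (pfst z) (psnd z))"
      "\<And>x y. eval halting_problem g x = Some y \<Longrightarrow> \<forall>\<^sub>F n in sequentially. e n x = y"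
    by blast
  define h where "h n x =
    rec_nat (d n (pfst x)) (\<lambda>k r. e n (prod_encode (pfst x, prod_encode (k, r)))) (psnd x)" for n x
  have "\<forall>\<^sub>F n in sequentially. h n (prod_encode (a, k)) = y"
    if "eval halting_problem (PrimRec f g) (prod_encode (a, k)) = Some y" for a k y
    using that
  proof (induction k arbitrary: y)
    case 0
    then show ?case by (simp add: h_def d(2))
  next
    case (Suc k)
    then obtain r where r: "eval halting_problem (PrimRec f g) (prod_encode (a, k)) = Some r"
      "eval halting_problem g (prod_encode (a, prod_encode (k, r))) = Some y"
      by (auto simp: bind_eq_Some_conv)
    from Suc.IH[OF r(1)] e(2)[OF r(2)] show ?case by eventually_elim (simp add: h_def)
  qed
  then have "\<forall>\<^sub>F n in sequentially. h n x = y"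
    if "eval halting_problem (PrimRec f g) x = Some y" for x y
    using that by (metis prod.collapse prod_decode_inverse)
  moreover have "computable_in {} (\<lambda>z. h (pfst z) (psnd z))"
    unfolding h_def by (intro computable computable_in_comp2[OF d(1)] computable_in_comp2[OF e(1)])
  ultimately show ?case by blast
next
  case (Mu f)
  then obtain e where e: "computable_in {} (\<lambda>z. e (pfst z) (psnd z))"
      "\<And>x y. eval halting_problem f x = Some y \<Longrightarrow> \<forall>\<^sub>F n in sequentially. e n x = y"
    by blast
  \<comment> \<open>A total stand-in for minimisation: the search is cut off at \<open>n\<close>,
    and the sum is the length of the initial run of positive guesses, that is, the first zero if it
    lies below \<open>n\<close>.\<close>
  define h where "h n x = (\<Sum>i<n. of_bool (\<forall>j<Suc i. 0 < e n (prod_encode (x, j))) :: nat)" for n x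
  have "\<forall>\<^sub>F n in sequentially. h n x = y"
    if "eval halting_problem (Mu f) x = Some y" for x y
  proof -
    have f: "eval halting_problem f (prod_encode (x, y)) = Some 0"
      "\<forall>i<y. \<exists>v. eval halting_problem f (prod_encode (x, i)) = Some (Suc v)"
      using that unfolding eval_Mu_eq_Some_iff by blast+
    have "\<forall>\<^sub>F n in sequentially. 0 < e n (prod_encode (x, i))" if i: "i < y" for i
    proof -
      obtain v where "eval halting_problem f (prod_encode (x, i)) = Some (Suc v)"
        using f i by blast
      from e(2)[OF this] show ?thesis by eventually_elim simp
    qed
    then have "\<forall>\<^sub>F n in sequentially. \<forall>i\<in>{..<y}. 0 < e n (prod_encode (x, i))"
      by (intro eventually_ball_finite) auto
    with e(2)[OF f(1)] eventually_gt_at_top[of y] show ?thesis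
    proof eventually_elim
      case (elim n)
      have "i < n \<and> (\<forall>j<Suc i. 0 < e n (prod_encode (x, j))) \<longleftrightarrow> i < y" for i
      proof
        assume *: "i < n \<and> (\<forall>j<Suc i. 0 < e n (prod_encode (x, j)))"
        show "i < y"
        proof (rule ccontr)
          assume "\<not> i < y"
          then have "0 < e n (prod_encode (x, y))" using * by simp
          then show False using elim(1) by simp
        qed
      qed (use elim in auto)
      then have "{i. i < n \<and> (\<forall>j<Suc i. 0 < e n (prod_encode (x, j)))} = {..<y}" by blast
      then show ?case by (simp add: h_def Int_def)
    qed
  qed
  moreover have "computable_in {} (\<lambda>z. h (pfst z) (psnd z))"
    unfolding h_def by (intro computable computable_in_comp2[OF e(1)])
  ultimately show ?case by blast
qed

lemma limit_lemma:
  assumes "computable_in halting_problem f"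
  obtains e where "computable_in {} (\<lambda>z. e (pfst z) (psnd z))"
    and "\<And>x. \<forall>\<^sub>F n in sequentially. e n x = f x"
  using assms limit_lemma_prog unfolding computable_in_def by metis

subsection \<open>Lower semicomputability via dyadic rationals\<close>

text \<open>
  For \<^const>\<open>int_decode\<close>, the parity is the sign and \<open>Suc n div 2\<close> the absolute value.
\<close>

definition dyadic_floor :: "nat \<Rightarrow> nat \<Rightarrow> nat" where
  "dyadic_floor s c =
     (if even (pfst c) \<and> even (psnd c) \<or> odd (pfst c) \<and> odd (psnd c)
      then 2 ^ s * (Suc (pfst c) div 2) div (Suc (psnd c) div 2) else 0)"

lemma int_decode_eq_if: "int_decode n = (if even n then int (n div 2) else - int (n div 2) - 1)"
  by (simp add: int_decode_def sum_decode_def)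

text \<open>Equal parities of the two integer codes give a nonnegative quotient, whose floor is
  integer division; unequal parities give a quotient at most 0, which \<open>nat\<close> sends to 0.
  A zero denominator yields 0 on both sides.\<close>

lemma dyadic_floor_eq: "dyadic_floor s c = nat \<lfloor>2 ^ s * real_of_rat (nat_to_rat_surj c)\<rfloor>"
proof -
  obtain a b where c: "prod_decode c = (a, b)" by fastforce
  have q: "real_of_rat (nat_to_rat_surj c) = real_of_int (int_decode a) / real_of_int (int_decode b)"
    by (simp add: nat_to_rat_surj_def c Fract_of_int_quotient of_rat_divide)
  have fl: "nat \<lfloor>real k / real l\<rfloor> = k div l" for k l
    by (metis floor_divide_of_nat_eq nat_int)
  have ev: "real_of_int (int_decode n) = real (Suc n div 2)" if "even n" for n
    using that by (simp add: int_decode_eq_if)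
  have od: "real_of_int (int_decode n) = - real (Suc n div 2)" if "odd n" for n
    using that by (auto simp: int_decode_eq_if elim!: oddE)
  show ?thesis
  proof (cases "even a = even b")
    case True
    then have "real_of_rat (nat_to_rat_surj c) = real (Suc a div 2) / real (Suc b div 2)"
      unfolding q by (cases "even a") (simp_all add: ev od del: of_nat_Suc)
    then have "2 ^ s * real_of_rat (nat_to_rat_surj c) =
        real (2 ^ s * (Suc a div 2)) / real (Suc b div 2)" by simp
    then show ?thesis using True by (simp only: fl) (auto simp: dyadic_floor_def c)
  next
    case False
    then have "real_of_rat (nat_to_rat_surj c) = - (real (Suc a div 2) / real (Suc b div 2))"
      unfolding q by (cases "even a") (simp_all add: ev od del: of_nat_Suc)
    then have "2 ^ s * real_of_rat (nat_to_rat_surj c) \<le> 0"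
      by (simp add: mult_nonneg_nonpos)
    then have "\<lfloor>2 ^ s * real_of_rat (nat_to_rat_surj c)\<rfloor> \<le> 0" by linarith
    then show ?thesis using False by (auto simp: dyadic_floor_def c)
  qed
qed

lemma computable_in_dyadic_floor [computable]:
  assumes "computable_in A f" "computable_in A g"
  shows "computable_in A (\<lambda>x. dyadic_floor (f x) (g x))"
  unfolding dyadic_floor_def by (intro computable assms)

text \<open>Rounding down to multiples of \<open>1 / 2 ^ s\<close> loses at most
  \<open>1 / 2 ^ s\<close> and so keeps the limit, while all further arithmetic takes place in
  natural numbers. Negative approximations are raised to 0, which stays below \<open>a z\<close> by
  nonnegativity.\<close>

lemma lower_semicomputable_in_dyadic_approx:
  assumes "lower_semicomputable_in A code a" "\<And>z. 0 \<le> a z"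
  obtains u where "computable_in A (\<lambda>z. u (pfst z) (psnd z))"
    and "\<And>z s. real (u (code z) s) / 2 ^ s \<le> a z"
    and "\<And>z. (\<lambda>s. real (u (code z) s) / 2 ^ s) \<longlonglongrightarrow> a z"
proof -
  obtain q g where g: "computable_in A g"
    and qg: "\<And>z s. q z s = nat_to_rat_surj (g (prod_encode (code z, s)))"
    and inc: "\<And>z. incseq (q z)" and lim: "\<And>z. (\<lambda>s. real_of_rat (q z s)) \<longlonglongrightarrow> a z"
    using assms(1) unfolding lower_semicomputable_in_def computable_rat_in_def by blast
  define u where "u k s = dyadic_floor s (g (prod_encode (k, s)))" for k s
  have u: "real (u (code z) s) = real (nat \<lfloor>2 ^ s * real_of_rat (q z s)\<rfloor>)" for z s
    by (simp add: u_def dyadic_floor_eq qg)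
  have q_le: "real_of_rat (q z s) \<le> a z" for z s
  proof (rule incseq_le[OF _ lim])
    show "incseq (\<lambda>s. real_of_rat (q z s))" using inc[of z] by (simp add: incseq_def of_rat_less_eq)
  qed
  have le: "real (u (code z) s) / 2 ^ s \<le> a z" for z s
  proof -
    have "2 ^ s * real_of_rat (q z s) \<le> 2 ^ s * a z" using q_le by simp
    moreover have "0 \<le> 2 ^ s * a z" using assms(2) by simp
    ultimately have "real (u (code z) s) \<le> 2 ^ s * a z" unfolding u by linarith
    then show ?thesis by (simp add: field_simps)
  qed
  have ge: "real_of_rat (q z s) - (1/2) ^ s \<le> real (u (code z) s) / 2 ^ s" for z s
  proof -
    have "2 ^ s * real_of_rat (q z s) - 1 \<le> real (u (code z) s)" unfolding u by linarith
    then have "(2 ^ s * real_of_rat (q z s) - 1) / 2 ^ s \<le> real (u (code z) s) / 2 ^ s"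
      by (rule divide_right_mono) simp
    then show ?thesis by (simp add: diff_divide_distrib power_one_over)
  qed
  have "(\<lambda>s. real_of_rat (q z s) - (1/2) ^ s) \<longlonglongrightarrow> a z - 0" for z
    by (intro tendsto_diff lim LIMSEQ_power_zero) simp
  then have lower: "(\<lambda>s. real_of_rat (q z s) - (1/2) ^ s) \<longlonglongrightarrow> a z" for z by simp
  have "(\<lambda>s. real (u (code z) s) / 2 ^ s) \<longlonglongrightarrow> a z" for z
    by (rule tendsto_sandwich[OF _ _ lower tendsto_const]) (simp_all add: ge le)
  moreover have "computable_in A (\<lambda>z. u (pfst z) (psnd z))"
    unfolding u_def by (intro computable computable_in_comp[OF g])
  ultimately show ?thesis using le that by blast
qed

lemma lower_semicomputable_in_dyadicI:
  assumes w: "computable_in A (\<lambda>z. w (pfst z) (psnd z))"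
    and d: "computable_in A (\<lambda>z. d (pfst z) (psnd z))"
    and inc: "\<And>z. incseq (\<lambda>s. real (w (code z) s) / 2 ^ d (code z) s)"
    and lim: "\<And>z. (\<lambda>s. real (w (code z) s) / 2 ^ d (code z) s) \<longlonglongrightarrow> a z"
  shows "lower_semicomputable_in A code a"
proof -
  \<comment> \<open>Doubling gives even codes, which \<open>int_decode\<close> reads as nonnegative
    integers.\<close>
  define g where "g z = prod_encode (2 * w (pfst z) (psnd z), 2 * 2 ^ d (pfst z) (psnd z))" for z
  define q where "q z s = nat_to_rat_surj (g (prod_encode (code z, s)))" for z s
  have q: "real_of_rat (q z s) = real (w (code z) s) / 2 ^ d (code z) s" for z s
    by (simp add: q_def g_def nat_to_rat_surj_def int_decode_eq_if Fract_of_int_quotient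
        of_rat_divide of_rat_power)
  have "incseq (q z)" for z
    using inc[of z] by (simp add: incseq_def of_rat_less_eq flip: q)
  moreover have "(\<lambda>s. real_of_rat (q z s)) \<longlonglongrightarrow> a z" for z
    using lim[of z] by (simp add: q)
  moreover have "computable_in A g"
    unfolding g_def by (intro computable w d)
  then have "computable_rat_in A code q"
    unfolding computable_rat_in_def using q_def by blast
  ultimately show ?thesis unfolding lower_semicomputable_in_def by blast
qed

section \<open>Semimeasures through partial sums over the numbers of strings\<close>

lemma semimeasure_sum_le:
  assumes "semimeasure a"
  shows "(\<Sum>i<n. a (inv string_code i)) \<le> 1"
proof -
  have inj: "inj_on (inv string_code) {..<n}"
    by (rule inj_on_subset[OF bij_is_inj[OF bij_imp_bij_inv[OF bij_string_code]]]) simp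
  have "(\<Sum>i<n. a (inv string_code i)) = sum a (inv string_code ` {..<n})"
    using sum.reindex[OF inj, of a] by (simp add: o_def)
  also have "\<dots> \<le> (\<Sum>\<^sub>\<infinity>x. a x)"
    using assms unfolding semimeasure_def by (intro finite_sum_le_infsum) auto
  finally show ?thesis using assms unfolding semimeasure_def by linarith
qed

lemma semimeasureI:
  assumes nonneg: "\<And>i. 0 \<le> b i" and le: "\<And>n. (\<Sum>i<n. b i) \<le> 1"
  shows "semimeasure (\<lambda>x. b (string_code x))"
proof -
  have fin: "(\<Sum>x\<in>F. b (string_code x)) \<le> 1" if F: "finite F" for F
  proof -
    have inj: "inj_on string_code F"
      by (rule inj_on_subset[OF bij_is_inj[OF bij_string_code]]) simp
    obtain n where n: "string_code ` F \<subseteq> {..<n}"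
      using finite_nat_bounded[OF finite_imageI[OF F]] by blast
    have "(\<Sum>x\<in>F. b (string_code x)) = sum b (string_code ` F)"
      using sum.reindex[OF inj, of b] by (simp add: o_def)
    also have "\<dots> \<le> (\<Sum>i<n. b i)"
      by (intro sum_mono2) (use n nonneg in auto)
    finally show ?thesis using le[of n] by linarith
  qed
  have "(\<lambda>x. b (string_code x)) summable_on UNIV"
    using fin nonneg by (intro nonneg_bdd_above_summable_on bdd_aboveI2[of _ _ 1]) auto
  moreover from this have "(\<Sum>\<^sub>\<infinity>x. b (string_code x)) \<le> 1"
    by (intro infsum_le_finite_sums) (auto intro: fin)
  ultimately show ?thesis unfolding semimeasure_def using nonneg by blast
qed

subsection \<open>The lower bound\<close>

lemma dyadic_rescale:
  fixes m t K :: nat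
  assumes "t \<le> K"
  shows "real (m * 2 ^ (K - t)) / 2 ^ K = real m / 2 ^ t"
proof -
  have "(2::real) ^ K = 2 ^ t * 2 ^ (K - t)" using assms by (simp flip: power_add)
  then show ?thesis by simp
qed

text \<open>The stage-\<open>n\<close> guesses may be wrong and their mass too large, so only a
  cutoff at which they fit is used. Any fixed cutoff fits once its guesses are correct, since these
  lie below the semimeasure \<open>a\<close>; hence the cutoffs tend to infinity.\<close>

lemma conditional_minorant:
  assumes "lsc_semimeasure_in halting_problem a"
  obtains b where "lsc_conditional_semimeasure b"
    and "\<And>x r. r < a x \<Longrightarrow> \<forall>\<^sub>F n in sequentially. r < b x n"
proof -
  have lsc: "lower_semicomputable_in halting_problem string_code a" and sm: "semimeasure a"
    using assms unfolding lsc_semimeasure_in_def by blast+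
  then have nonneg: "\<And>x. 0 \<le> a x" unfolding semimeasure_def by blast
  obtain u where u: "computable_in halting_problem (\<lambda>z. u (pfst z) (psnd z))"
    and u_le: "\<And>x s. real (u (string_code x) s) / 2 ^ s \<le> a x"
    and u_lim: "\<And>x. (\<lambda>s. real (u (string_code x) s) / 2 ^ s) \<longlonglongrightarrow> a x"
    using lower_semicomputable_in_dyadic_approx[OF lsc nonneg] by blast
  obtain e where e: "computable_in {} (\<lambda>z. e (pfst z) (psnd z))"
    and e_lim: "\<And>z. \<forall>\<^sub>F n in sequentially. e n z = u (pfst z) (psnd z)"
    using limit_lemma[OF u] by blast
  \<comment> \<open>The best stage-\<open>n\<close> guess for string number \<open>y\<close> among
    the precisions up to \<open>K\<close>, in units of \<open>1 / 2 ^ K\<close>.\<close>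
  define W where "W n K y = Max ((\<lambda>s. e n (prod_encode (y, s)) * 2 ^ (K - s)) ` {..K})" for n K y
  define fits where "fits n K \<longleftrightarrow> (\<Sum>y<K. W n K y) \<le> 2 ^ K" for n K
  \<comment> \<open>The largest fitting cutoff up to \<open>n\<close>. Cutoff 0 always fits, its sum
    being empty, so 0 is a safe default.\<close>
  define \<kappa> where "\<kappa> n = Max ((\<lambda>K. if fits n K then K else 0) ` {..n})" for n
  define w where "w n y = (if y < \<kappa> n then W n (\<kappa> n) y else 0)" for n y
  define b where "b x n = real (w n (string_code x)) / 2 ^ \<kappa> n" for x n
  have W_comp: "computable_in {} (\<lambda>x. W (f x) (g x) (h x))"
    if "computable_in {} f" "computable_in {} g" "computable_in {} h" for f g h
    unfolding W_def
    by (intro computable computable_in_comp2[OF e] computable_in_comp[OF that(1)]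
        computable_in_comp[OF that(2)] computable_in_comp[OF that(3)] that)
  have \<kappa>_comp: "computable_in {} (\<lambda>x. \<kappa> (f x))" if "computable_in {} f" for f
    unfolding \<kappa>_def fits_def
    by (intro computable W_comp computable_in_comp[OF that] that)
  have fits_\<kappa>: "fits n (\<kappa> n)" for n
  proof -
    have "\<kappa> n \<in> (\<lambda>K. if fits n K then K else 0) ` {..n}"
      unfolding \<kappa>_def by (rule Max_in) auto
    then obtain K where "\<kappa> n = (if fits n K then K else 0)" by blast
    then show ?thesis by (cases "fits n K") (simp_all add: fits_def)
  qed
  have sum_w: "(\<Sum>y<N. real (w n y) / 2 ^ \<kappa> n) \<le> 1" for n N
  proof -
    have "(\<Sum>y<N. w n y) \<le> (\<Sum>y<N + \<kappa> n. w n y)"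
      by (rule sum_mono2) auto
    also have "\<dots> = (\<Sum>y<\<kappa> n. W n (\<kappa> n) y)"
      by (rule sum.mono_neutral_cong_right) (auto simp: w_def)
    also have "\<dots> \<le> 2 ^ \<kappa> n" using fits_\<kappa> unfolding fits_def .
    finally have "real (\<Sum>y<N. w n y) \<le> 2 ^ \<kappa> n"
      by (metis of_nat_le_iff of_nat_numeral of_nat_power)
    then show ?thesis by (simp add: sum_divide_distrib[symmetric])
  qed
  \<comment> \<open>The values of \<open>b\<close> are computable dyadic numbers, so the
    approximating sequence is constant.\<close>
  have "lower_semicomputable_in {} pair_code (\<lambda>(x, n). b x n)"
  proof (rule lower_semicomputable_in_dyadicI)
    show "computable_in {} (\<lambda>z. w (psnd (pfst z)) (pfst (pfst z)))"
      unfolding w_def by (intro computable W_comp \<kappa>_comp)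
    show "computable_in {} (\<lambda>z. \<kappa> (psnd (pfst z)))"
      by (intro computable \<kappa>_comp)
  qed (auto simp: pair_code_def b_def)
  then have "lsc_conditional_semimeasure b"
    unfolding lsc_conditional_semimeasure_def b_def
    using semimeasureI[of "\<lambda>y. real (w _ y) / 2 ^ \<kappa> _", OF _ sum_w] by simp
  moreover have "\<forall>\<^sub>F n in sequentially. r < b x n" if r: "r < a x" for x r
  proof -
    have "\<forall>\<^sub>F s in sequentially. r < real (u (string_code x) s) / 2 ^ s"
      by (rule order_tendstoD(1)[OF u_lim r])
    then obtain s where s: "r < real (u (string_code x) s) / 2 ^ s"
      unfolding eventually_sequentially by blast
    \<comment> \<open>Large enough to cover the string \<open>x\<close> and the precision
      \<open>s\<close> at which \<open>r\<close> is exceeded.\<close>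
    define K where "K = max (Suc (string_code x)) s"
    have "\<forall>\<^sub>F n in sequentially. \<forall>z\<in>{..<K} \<times> {..K}. e n (prod_encode z) = u (fst z) (snd z)"
      by (rule eventually_ball_finite) (use e_lim[of "prod_encode _"] in auto)
    with eventually_ge_at_top[of K] show ?thesis
    proof eventually_elim
      case (elim n)
      have "real (W n K y) / 2 ^ K \<le> a (inv string_code y)" if y: "y < K" for y
      proof -
        have "W n K y \<in> (\<lambda>s. e n (prod_encode (y, s)) * 2 ^ (K - s)) ` {..K}"
          unfolding W_def by (rule Max_in) auto
        then obtain t where t: "t \<le> K" "W n K y = u y t * 2 ^ (K - t)" using elim y by auto
        have "real (u y t) / 2 ^ t \<le> a (inv string_code y)"
          using u_le[of "inv string_code y" t]
          by (simp add: bij_is_surj[OF bij_string_code] surj_f_inv_f)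
        then show ?thesis unfolding t(2) dyadic_rescale[OF t(1)] .
      qed
      then have "(\<Sum>y<K. real (W n K y) / 2 ^ K) \<le> (\<Sum>y<K. a (inv string_code y))"
        by (intro sum_mono) simp
      also have "\<dots> \<le> 1" by (rule semimeasure_sum_le[OF sm])
      finally have "real (\<Sum>y<K. W n K y) \<le> real (2 ^ K)"
        by (simp add: sum_divide_distrib[symmetric])
      then have "fits n K" unfolding fits_def by (simp only: of_nat_le_iff)
      then have "K \<le> \<kappa> n"
        unfolding \<kappa>_def using elim(1) by (intro Max_ge) (auto intro!: rev_image_eqI[of K])
      then have xs: "string_code x < \<kappa> n" "s \<le> \<kappa> n" by (auto simp: K_def)
      have es: "e n (prod_encode (string_code x, s)) = u (string_code x) s"
        using elim(2) by (auto simp: K_def)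
      \<comment> \<open>The cutoff \<open>\<kappa> n\<close> may exceed \<open>K\<close> and bring
        in wrong guesses, but under the maximum these can only raise the value above the correct
        guess at \<open>s\<close>.\<close>
      have "e n (prod_encode (string_code x, s)) * 2 ^ (\<kappa> n - s) \<le> W n (\<kappa> n) (string_code x)"
        unfolding W_def using xs by (intro Max_ge) auto
      then have "real (u (string_code x) s * 2 ^ (\<kappa> n - s)) \<le> real (w n (string_code x))"
        using xs unfolding es by (simp only: w_def of_nat_le_iff if_True)
      then have "real (u (string_code x) s) / 2 ^ s \<le> b x n"
        unfolding b_def dyadic_rescale[OF xs(2), symmetric] by (rule divide_right_mono) simp
      then show ?case using s by linarith
    qed
  qed
  ultimately show ?thesis using that by blast
qed

subsection \<open>The upper bound\<close>

text \<open>
  The number \<open>(y, (N, (i, e)))\<close> codes the request that string number \<open>y\<close> have conditional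
  probability at least \<open>i / 2 ^ e\<close> for all conditions \<open>n \<ge> N\<close>.  Since \<open>e\<close> is at most the code,
  the subtraction \<open>t - e\<close> in \<open>request_bound\<close> never truncates: the bound is exact in units
  of \<open>1 / 2 ^ t\<close>.
\<close>

definition request_value :: "nat \<Rightarrow> real" where
  "request_value j = real (pfst (psnd (psnd j))) / 2 ^ psnd (psnd (psnd j))"

definition request_bound :: "nat \<Rightarrow> nat \<Rightarrow> nat \<Rightarrow> nat \<Rightarrow> nat" where
  "request_bound L n t y =
     Max ((\<lambda>j. if j \<in> set_decode L \<and> pfst j = y \<and> pfst (psnd j) \<le> n
               then pfst (psnd (psnd j)) * 2 ^ (t - psnd (psnd (psnd j))) else 0) ` {..t})"

lemma pfst_le: "pfst z \<le> z"
  by (metis le_prod_encode_1 prod.collapse prod_decode_inverse)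

lemma psnd_le: "psnd z \<le> z"
  by (metis le_prod_encode_2 prod.collapse prod_decode_inverse)

lemma request_value_rescale:
  assumes "j \<le> t"
  shows "real (pfst (psnd (psnd j)) * 2 ^ (t - psnd (psnd (psnd j)))) / 2 ^ t = request_value j"
proof -
  have "psnd (psnd (psnd j)) \<le> t" using assms psnd_le le_trans by metis
  then show ?thesis unfolding request_value_def by (rule dyadic_rescale)
qed

lemma request_bound_ge:
  assumes "j \<in> set_decode L" "pfst j = y" "pfst (psnd j) \<le> n" "j \<le> t"
  shows "request_value j \<le> real (request_bound L n t y) / 2 ^ t"
proof -
  have "pfst (psnd (psnd j)) * 2 ^ (t - psnd (psnd (psnd j))) \<le> request_bound L n t y"
    unfolding request_bound_def using assms by (intro Max_ge) (auto intro!: rev_image_eqI[of j])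
  then show ?thesis
    unfolding request_value_rescale[OF assms(4), symmetric]
    by (intro divide_right_mono) (simp_all only: of_nat_le_iff, simp)
qed

lemma request_bound_leI:
  assumes "0 \<le> r"
    and "\<And>j. j \<in> set_decode L \<Longrightarrow> pfst j = y \<Longrightarrow> pfst (psnd j) \<le> n \<Longrightarrow> j \<le> t \<Longrightarrow> request_value j \<le> r"
  shows "real (request_bound L n t y) / 2 ^ t \<le> r"
proof -
  have "request_bound L n t y \<in>
      (\<lambda>j. if j \<in> set_decode L \<and> pfst j = y \<and> pfst (psnd j) \<le> n
           then pfst (psnd (psnd j)) * 2 ^ (t - psnd (psnd (psnd j))) else 0) ` {..t}"
    unfolding request_bound_def by (rule Max_in) auto
  then obtain j where j: "j \<le> t" and
    eq: "request_bound L n t y = (if j \<in> set_decode L \<and> pfst j = y \<and> pfst (psnd j) \<le> n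
           then pfst (psnd (psnd j)) * 2 ^ (t - psnd (psnd (psnd j))) else 0)"
    by blast
  show ?thesis
  proof (cases "j \<in> set_decode L \<and> pfst j = y \<and> pfst (psnd j) \<le> n")
    case True
    then have "real (request_bound L n t y) / 2 ^ t = request_value j"
      unfolding eq if_P[OF True] by (intro request_value_rescale[OF j])
    then show ?thesis using assms(2)[of j] True j by simp
  next
    case False
    then have "request_bound L n t y = 0" unfolding eq by (rule if_not_P)
    then show ?thesis using assms(1) by simp
  qed
qed

lemma request_bound_mono:
  assumes "set_decode L \<subseteq> set_decode L'" "n \<le> n'" "t \<le> t'"
  shows "real (request_bound L n t y) / 2 ^ t \<le> real (request_bound L' n' t' y) / 2 ^ t'"
  by (rule request_bound_leI) (use assms in \<open>auto intro!: request_bound_ge\<close>)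

lemma computable_in_request_bound [computable]:
  assumes "computable_in A L" "computable_in A n" "computable_in A t" "computable_in A y"
  shows "computable_in A (\<lambda>x. request_bound (L x) (n x) (t x) (y x))"
  unfolding request_bound_def
  by (intro computable computable_in_comp[OF assms(1)] computable_in_comp[OF assms(2)]
      computable_in_comp[OF assms(3)] computable_in_comp[OF assms(4)] assms)

section \<open>Greedy acceptance of requests\<close>

text \<open>The number \<open>w\<close> pairs a condition with a precision \<open>t\<close>; the
  first \<open>t\<close> strings are weighed in units of \<open>1 / 2 ^ t\<close>. Each check is
  finite, and only the quantification over \<open>w\<close> calls for an oracle.\<close>

definition overflow :: "(nat \<Rightarrow> nat \<Rightarrow> nat \<Rightarrow> nat) \<Rightarrow> nat \<Rightarrow> nat \<Rightarrow> bool" where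
  "overflow U L w \<longleftrightarrow>
     2 ^ psnd w < (\<Sum>y<psnd w. max (U y (pfst w) (psnd w)) (request_bound L (pfst w) (psnd w) y))"

text \<open>The accepted requests below \<open>n\<close> as a bit set: adding \<open>2 ^ k\<close>
  inserts \<open>k\<close>, because earlier stages hold only smaller numbers.\<close>

definition accepted :: "(nat \<Rightarrow> nat \<Rightarrow> nat \<Rightarrow> nat) \<Rightarrow> nat \<Rightarrow> nat" where
  "accepted U n = rec_nat 0 (\<lambda>k L. if \<exists>w. overflow U (2 ^ k + L) w then L else 2 ^ k + L) n"

lemma accepted_Suc:
  "accepted U (Suc n) =
     (if \<exists>w. overflow U (2 ^ n + accepted U n) w then accepted U n else 2 ^ n + accepted U n)"
  unfolding accepted_def by simp

lemma in_accepted_less: "j \<in> set_decode (accepted U n) \<Longrightarrow> j < n"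
proof (induction n arbitrary: j)
  case 0
  then show ?case by (simp add: accepted_def)
next
  case (Suc n)
  then have "n \<notin> set_decode (accepted U n)" by blast
  then have "set_decode (2 ^ n + accepted U n) = insert n (set_decode (accepted U n))"
    by (rule set_decode_plus_power_2)
  then show ?case using Suc by (auto simp: accepted_Suc less_Suc_eq split: if_splits)
qed

lemma set_decode_power_add_accepted:
  "set_decode (2 ^ n + accepted U n) = insert n (set_decode (accepted U n))"
  using in_accepted_less[of n U n] by (intro set_decode_plus_power_2) blast

lemma accepted_mono:
  assumes "m \<le> n"
  shows "set_decode (accepted U m) \<subseteq> set_decode (accepted U n)"
  by (rule lift_Suc_mono_le[OF _ assms]) (auto simp: accepted_Suc set_decode_power_add_accepted)

text \<open>Since \<open>U\<close> is computable without an oracle, existence of an overflow is an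
  enumerable property of the set code \<open>L\<close>, and each step of the recursion asks the
  halting problem once.\<close>

lemma computable_in_accepted:
  assumes U: "computable_in {} (\<lambda>z. U (pfst z) (pfst (psnd z)) (psnd (psnd z)))"
    and n: "computable_in halting_problem n"
  shows "computable_in halting_problem (\<lambda>x. accepted U (n x))"
proof -
  have U': "computable_in {} (\<lambda>x. U (a x) (b x) (c x))"
    if "computable_in {} a" "computable_in {} b" "computable_in {} c" for a b c
    using computable_in_comp[OF U, of "\<lambda>x. prod_encode (a x, prod_encode (b x, c x))"] that
    by (simp add: computable)
  have "decidable_in {} (\<lambda>z. overflow U (pfst z) (psnd z))"
    unfolding overflow_def max_def by (intro computable U')
  then have dec: "decidable_in halting_problem (\<lambda>L. \<exists>w. overflow U L w)"
    by (rule decidable_in_halting_problem_ex)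
  show ?thesis
    unfolding accepted_def by (intro computable decidable_in_comp[OF dec] n)
qed

text \<open>The value at a string is the supremum of its accepted requests. Finitely many accepted
  requests are all in force at one large condition, where their joint load is at most 1; this bounds
  the sum of the suprema.\<close>

lemma halting_majorant:
  assumes "lsc_conditional_semimeasure m"
  obtains a where "lsc_semimeasure_in halting_problem a"
    and "\<And>x. liminf (\<lambda>n. ereal (m x n)) \<le> ereal (a x)"
proof -
  define \<mu> where "\<mu> y n = m (inv string_code y) n" for y n
  have sm: "\<And>n. semimeasure (\<lambda>x. m x n)"
    and lsc: "lower_semicomputable_in {} pair_code (\<lambda>(x, n). m x n)"
    using assms unfolding lsc_conditional_semimeasure_def by blast+
  then have nonneg: "\<And>x n. 0 \<le> m x n" unfolding semimeasure_def by blast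
  have \<mu>_sum: "(\<Sum>y<N. \<mu> y n) \<le> 1" for n N
    unfolding \<mu>_def by (rule semimeasure_sum_le[OF sm])
  obtain u where u: "computable_in {} (\<lambda>z. u (pfst z) (psnd z))"
    and u_le: "\<And>z s. real (u (pair_code z) s) / 2 ^ s \<le> (\<lambda>(x, n). m x n) z"
    and u_lim: "\<And>z. (\<lambda>s. real (u (pair_code z) s) / 2 ^ s) \<longlonglongrightarrow> (\<lambda>(x, n). m x n) z"
    by (rule lower_semicomputable_in_dyadic_approx[OF lsc]) (use nonneg in auto)
  define U where "U y n t = u (prod_encode (y, n)) t" for y n t
  have U_comp: "computable_in {} (\<lambda>z. U (pfst z) (pfst (psnd z)) (psnd (psnd z)))"
    unfolding U_def by (intro computable computable_in_comp2[OF u])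
  have pc: "pair_code (inv string_code y, n) = prod_encode (y, n)" for y n
    by (simp add: pair_code_def bij_is_surj[OF bij_string_code] surj_f_inv_f)
  have U_le: "real (U y n t) / 2 ^ t \<le> \<mu> y n" for y n t
    using u_le[of "(inv string_code y, n)" t] by (simp add: pc U_def \<mu>_def)
  have U_lim: "(\<lambda>t. real (U y n t) / 2 ^ t) \<longlonglongrightarrow> \<mu> y n" for y n
    using u_lim[of "(inv string_code y, n)"] by (simp add: pc U_def \<mu>_def)
  \<comment> \<open>The real-valued form of the summand in \<open>overflow\<close>: what string
    number \<open>y\<close> must carry at condition \<open>n\<close>, seen at precision
    \<open>t\<close>.\<close>
  define load where "load L n t y = max (real (U y n t) / 2 ^ t) (real (request_bound L n t y) / 2 ^ t)"
    for L n t y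
  have overflow_iff: "(\<exists>w. overflow U L w) \<longleftrightarrow> (\<exists>n t. 1 < (\<Sum>y<t. load L n t y))" for L
  proof -
    have "overflow U L (prod_encode (n, t)) \<longleftrightarrow> 1 < (\<Sum>y<t. load L n t y)" for n t
    proof -
      have "load L n t y = real (max (U y n t) (request_bound L n t y)) / 2 ^ t" for y
        unfolding load_def by (simp add: max_def divide_le_cancel)
      then have "1 < (\<Sum>y<t. load L n t y) \<longleftrightarrow>
          real (2 ^ t) < real (\<Sum>y<t. max (U y n t) (request_bound L n t y))"
        by (simp add: sum_divide_distrib[symmetric] del: of_nat_max)
      then show ?thesis unfolding of_nat_less_iff by (simp add: overflow_def)
    qed
    then show ?thesis by (metis prod.collapse prod_decode_inverse)
  qed
  \<comment> \<open>The invariant of the greedy process: without requests the load is bounded by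
    \<open>m\<close>, and a request enters only if it breaks no bound.\<close>
  have load_accepted: "(\<Sum>y<t. load (accepted U k) n t y) \<le> 1" for k n t
  proof (induction k arbitrary: n t)
    case 0
    have "real (request_bound (accepted U 0) n t y) / 2 ^ t \<le> 0" for y
      by (rule request_bound_leI) (simp_all add: accepted_def)
    then have "load (accepted U 0) n t y \<le> \<mu> y n" for y
      using U_le[of y n t] nonneg[of "inv string_code y" n] unfolding load_def \<mu>_def
      by (meson max.boundedI order_trans)
    then have "(\<Sum>y<t. load (accepted U 0) n t y) \<le> (\<Sum>y<t. \<mu> y n)" by (intro sum_mono)
    then show ?case using \<mu>_sum[of n t] by linarith
  next
    case (Suc k)
    show ?case
    proof (cases "\<exists>w. overflow U (2 ^ k + accepted U k) w")
      case True
      then show ?thesis using Suc.IH by (simp add: accepted_Suc)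
    next
      case False
      then have "\<forall>n t. (\<Sum>y<t. load (2 ^ k + accepted U k) n t y) \<le> 1"
        unfolding overflow_iff by (simp add: not_less)
      then show ?thesis unfolding accepted_Suc if_not_P[OF False] by blast
    qed
  qed
  \<comment> \<open>A request that \<open>m\<close> already fulfils is never rejected: it does not
    push the load above the maximum of \<open>\<mu>\<close> and the earlier requests.\<close>
  have accept: "k \<in> set_decode (accepted U (Suc k))"
    if k: "\<And>n. pfst (psnd k) \<le> n \<Longrightarrow> request_value k \<le> \<mu> (pfst k) n" for k
  proof -
    let ?L = "accepted U k" and ?L' = "2 ^ k + accepted U k"
    have "(\<Sum>y<t. load ?L' n t y) \<le> 1" for n t
    proof -
      have "load ?L' n t y \<le> max (\<mu> y n) (real (request_bound ?L n t y) / 2 ^ t)" (is "_ \<le> ?r") for y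
      proof -
        have "real (request_bound ?L' n t y) / 2 ^ t \<le> ?r"
        proof (rule request_bound_leI)
          show "0 \<le> ?r" by (simp add: le_max_iff_disj)
          show "request_value j \<le> ?r"
            if "j \<in> set_decode ?L'" "pfst j = y" "pfst (psnd j) \<le> n" "j \<le> t" for j
          proof (cases "j = k")
            case True
            then show ?thesis using k[of n] that by (simp add: le_max_iff_disj)
          next
            case False
            then have "request_value j \<le> real (request_bound ?L n t y) / 2 ^ t"
              using that by (intro request_bound_ge) (simp_all add: set_decode_power_add_accepted)
            then show ?thesis by simp
          qed
        qed
        moreover have "real (U y n t) / 2 ^ t \<le> ?r" using U_le[of y n t] by simp
        ultimately show ?thesis unfolding load_def by simp
      qed
      then have "(\<Sum>y<t. load ?L' n t y) \<le>
          (\<Sum>y<t. max (\<mu> y n) (real (request_bound ?L n t y) / 2 ^ t))" by (intro sum_mono)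
      \<comment> \<open>The invariant speaks of approximations and not of \<open>\<mu>\<close>
        itself, so the precision \<open>T\<close> tends to infinity while the \<open>t\<close>
        strings stay fixed.\<close>
      also have "\<dots> \<le> 1"
      proof (rule LIMSEQ_le_const2)
        show "(\<lambda>T. \<Sum>y<t. max (real (U y n T) / 2 ^ T) (real (request_bound ?L n t y) / 2 ^ t))
            \<longlonglongrightarrow> (\<Sum>y<t. max (\<mu> y n) (real (request_bound ?L n t y) / 2 ^ t))"
          by (intro tendsto_sum tendsto_max U_lim tendsto_const)
        have "(\<Sum>y<t. max (real (U y n T) / 2 ^ T) (real (request_bound ?L n t y) / 2 ^ t)) \<le> 1"
          if T: "t \<le> T" for T
        proof -
          have "(\<Sum>y<t. max (real (U y n T) / 2 ^ T) (real (request_bound ?L n t y) / 2 ^ t))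
              \<le> (\<Sum>y<t. load ?L n T y)"
            unfolding load_def
            by (intro sum_mono max.mono request_bound_mono) (simp_all add: T)
          also have "\<dots> \<le> (\<Sum>y<T. load ?L n T y)"
            by (rule sum_mono2) (use T in \<open>auto simp: load_def le_max_iff_disj\<close>)
          finally show ?thesis using load_accepted[of k n T] by linarith
        qed
        then show "\<exists>N. \<forall>T\<ge>N.
            (\<Sum>y<t. max (real (U y n T) / 2 ^ T) (real (request_bound ?L n t y) / 2 ^ t)) \<le> 1"
          by blast
      qed
      finally show ?thesis .
    qed
    then have "\<not> (\<exists>w. overflow U ?L' w)" unfolding overflow_iff by (simp add: not_less)
    then show ?thesis by (simp add: accepted_Suc set_decode_power_add_accepted)
  qed
  \<comment> \<open>One parameter drives requests, condition and precision together, so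
    \<open>A y\<close> is increasing and every accepted request comes into force.\<close>
  define A where "A y s = real (request_bound (accepted U s) s s y) / 2 ^ s" for y s
  have A_inc: "incseq (A y)" for y
    unfolding A_def incseq_def by (intro allI impI request_bound_mono accepted_mono)
  have A_nonneg: "0 \<le> A y s" for y s by (simp add: A_def)
  have A_sum: "(\<Sum>y<N. A y s) \<le> 1" for N s
  proof -
    \<comment> \<open>A load at precision \<open>t\<close> is summed over \<open>t\<close> strings
      only, so the precision is raised to cover all \<open>N\<close> strings.\<close>
    have "A y s \<le> load (accepted U s) s (max N s) y" for y
      unfolding A_def load_def by (intro max.coboundedI2 request_bound_mono) auto
    then have "(\<Sum>y<N. A y s) \<le> (\<Sum>y<N. load (accepted U s) s (max N s) y)" by (intro sum_mono)
    also have "\<dots> \<le> (\<Sum>y<max N s. load (accepted U s) s (max N s) y)"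
      by (rule sum_mono2) (auto simp: load_def le_max_iff_disj)
    finally show ?thesis using load_accepted[where k = s and n = s and t = "max N s"] by linarith
  qed
  have "A y s \<le> 1" for y s
    using member_le_sum[of y "{..<Suc y}" "\<lambda>y. A y s"] A_nonneg A_sum[of s "Suc y"] by force
  then have "\<exists>l. A y \<longlonglongrightarrow> l" for y
    using incseq_convergent[OF A_inc] by metis
  then obtain a where a: "\<And>y. A y \<longlonglongrightarrow> a y" by metis
  have a_ge: "A y s \<le> a y" for y s by (rule incseq_le[OF A_inc a])
  have "semimeasure (\<lambda>x. a (string_code x))"
  proof (rule semimeasureI)
    show "0 \<le> a y" for y using A_nonneg a_ge order_trans by metis
    show "(\<Sum>y<N. a y) \<le> 1" for N
      by (rule LIMSEQ_le_const2[OF tendsto_sum[OF a]]) (use A_sum in auto)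
  qed
  moreover have "lower_semicomputable_in halting_problem string_code (\<lambda>x. a (string_code x))"
  proof (rule lower_semicomputable_in_dyadicI)
    show "computable_in halting_problem (\<lambda>z. request_bound (accepted U (psnd z)) (psnd z) (psnd z) (pfst z))"
      by (intro computable computable_in_accepted[OF U_comp])
    show "computable_in halting_problem (\<lambda>z. psnd z)" by (intro computable)
  qed (use A_inc a in \<open>simp_all add: A_def[abs_def]\<close>)
  ultimately have "lsc_semimeasure_in halting_problem (\<lambda>x. a (string_code x))"
    unfolding lsc_semimeasure_in_def by blast
  moreover have "liminf (\<lambda>n. ereal (m x n)) \<le> ereal (a (string_code x))" for x
  proof (rule ccontr)
    let ?y = "string_code x"
    assume "\<not> ?thesis"
    then obtain r where r: "a ?y < r" "ereal r < liminf (\<lambda>n. ereal (m x n))"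
      using ereal_dense2[of "ereal (a ?y)"] by (auto simp: not_le)
    \<comment> \<open>The rounding error must be smaller than the gap, so that \<open>r\<close>
      rounded down to a multiple of \<open>1 / 2 ^ e\<close> still exceeds
      \<open>a ?y\<close>.\<close>
    obtain e where e: "(1/2) ^ e < r - a ?y"
      using real_arch_pow_inv[of "r - a ?y" "1/2"] r by auto
    define i where "i = nat \<lfloor>2 ^ e * r\<rfloor>"
    have "0 \<le> r" using a_ge[of ?y 0] A_nonneg[of ?y 0] r(1) by linarith
    then have "0 \<le> 2 ^ e * r" by simp
    then have i: "real i \<le> 2 ^ e * r" "2 ^ e * r < real i + 1"
      unfolding i_def by linarith+
    have "a ?y < real i / 2 ^ e"
    proof -
      have "2 ^ e * (1/2) ^ e = (1::real)" by (simp flip: power_mult_distrib)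
      moreover have "2 ^ e * (1/2) ^ e < 2 ^ e * (r - a ?y)" using e by simp
      ultimately have "2 ^ e * a ?y < real i" using i(2) by (simp add: right_diff_distrib)
      then show ?thesis by (simp add: field_simps)
    qed
    moreover have "real i / 2 ^ e \<le> a ?y"
    proof -
      have "\<forall>\<^sub>F n in sequentially. ereal r < ereal (m x n)" using r(2) by (rule less_LiminfD)
      then obtain N where N: "\<And>n. N \<le> n \<Longrightarrow> r < m x n" by (auto simp: eventually_sequentially)
      \<comment> \<open>The request that contradicts the choice of \<open>r\<close>:
        \<open>m\<close> fulfils it from \<open>N\<close> on, so it is accepted, and since
        \<open>N\<close> is at most its code it is in force at stage \<open>Suc k\<close>.\<close>
      define k where "k = prod_encode (?y, prod_encode (N, prod_encode (i, e)))"
      have k: "pfst k = ?y" "pfst (psnd k) = N" "request_value k = real i / 2 ^ e"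
        by (simp_all add: k_def request_value_def)
      have "request_value k \<le> r" using i(1) unfolding k by (simp add: field_simps)
      then have "k \<in> set_decode (accepted U (Suc k))"
        using N by (intro accept) (auto simp: k \<mu>_def bij_is_inj[OF bij_string_code] intro: less_imp_le order_trans)
      then have "request_value k \<le> A ?y (Suc k)"
        unfolding A_def using pfst_le[of "psnd k"] psnd_le[of k] by (intro request_bound_ge) (auto simp: k(1))
      then show ?thesis using a_ge[of ?y "Suc k"] unfolding k by linarith
    qed
    ultimately show False by linarith
  qed
  ultimately show ?thesis using that by blast
qed

text \<open>Maximality of \<open>m_halt\<close> applied to the majorant of \<open>m_cond\<close>
  gives the upper bound; maximality of \<open>m_cond\<close> applied to the minorant built from
  \<open>m_halt\<close> gives the lower one. The larger of the two factors serves both.\<close>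

theorem theorem2:
  fixes m_halt :: "bool list \<Rightarrow> real"
    and m_cond :: "bool list \<Rightarrow> nat \<Rightarrow> real"
  assumes "a_priori_probability_in halting_problem m_halt"
    and "conditional_a_priori_probability m_cond"
  shows "\<exists>c::real. c > 0 \<and>
    (\<forall>x :: bool list.
       ereal (1 / c * m_halt x) \<le> liminf (\<lambda>n. ereal (m_cond x n)) \<and>
       liminf (\<lambda>n. ereal (m_cond x n)) \<le> ereal (c * m_halt x))"
proof -
  have halt: "lsc_semimeasure_in halting_problem m_halt"
    and halt_max: "\<And>a. lsc_semimeasure_in halting_problem a \<Longrightarrow> \<exists>c>0. \<forall>x. a x \<le> c * m_halt x"
    using assms(1) unfolding a_priori_probability_in_def by blast+
  have cond: "lsc_conditional_semimeasure m_cond"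
    and cond_max: "\<And>b. lsc_conditional_semimeasure b \<Longrightarrow> \<exists>c>0. \<forall>x n. b x n \<le> c * m_cond x n"
    using assms(2) unfolding conditional_a_priori_probability_def by blast+
  have halt_nonneg: "0 \<le> m_halt x" for x
    using halt unfolding lsc_semimeasure_in_def semimeasure_def by blast
  have cond_nonneg: "0 \<le> m_cond x n" for x n
    using cond unfolding lsc_conditional_semimeasure_def semimeasure_def by blast
  obtain a where a: "lsc_semimeasure_in halting_problem a"
    "\<And>x. liminf (\<lambda>n. ereal (m_cond x n)) \<le> ereal (a x)"
    using halting_majorant[OF cond] by blast
  obtain b where b: "lsc_conditional_semimeasure b"
    "\<And>x r. r < m_halt x \<Longrightarrow> \<forall>\<^sub>F n in sequentially. r < b x n"
    using conditional_minorant[OF halt] by blast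
  obtain c1 where c1: "c1 > 0" "\<And>x. a x \<le> c1 * m_halt x" using halt_max[OF a(1)] by blast
  obtain c2 where c2: "c2 > 0" "\<And>x n. b x n \<le> c2 * m_cond x n" using cond_max[OF b(1)] by blast
  define c where "c = max c1 c2"
  have c: "c > 0" "c1 \<le> c" "c2 \<le> c" using c1 by (auto simp: c_def)
  have "ereal (1 / c * m_halt x) \<le> liminf (\<lambda>n. ereal (m_cond x n))" for x
    unfolding le_Liminf_iff
  proof (intro allI impI)
    fix y assume "y < ereal (1 / c * m_halt x)"
    \<comment> \<open>The bound \<open>y\<close> may be minus infinity, so a real number is
      interposed before rescaling by \<open>c\<close>.\<close>
    then obtain r where r: "y < ereal r" "r < 1 / c * m_halt x" using ereal_dense2 by force
    then have "c * r < m_halt x" using c(1) by (simp add: field_simps)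
    from b(2)[OF this] show "\<forall>\<^sub>F n in sequentially. y < ereal (m_cond x n)"
    proof eventually_elim
      case (elim n)
      also have "b x n \<le> c2 * m_cond x n" by (rule c2)
      also have "\<dots> \<le> c * m_cond x n" using c(3) cond_nonneg by (rule mult_right_mono)
      finally have "r < m_cond x n" using c(1) by simp
      then show ?case using r(1) by (meson ereal_less_eq(3) less_imp_le order_less_le_trans)
    qed
  qed
  moreover have "liminf (\<lambda>n. ereal (m_cond x n)) \<le> ereal (c * m_halt x)" for x
  proof -
    have "a x \<le> c * m_halt x"
      using c1(2)[of x] mult_right_mono[OF c(2) halt_nonneg[of x]] by linarith
    then show ?thesis using a(2)[of x] by (meson ereal_less_eq(3) order_trans)
  qed
  ultimately show ?thesis using c(1) by blast
qed

end
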